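(* Let $0\le\eta<1$ and $\delta\ge 0$ be real numbers. For any positive integers $m,n$ such that $m\ge n$, we have $\ell_{m,n}(\eta,\delta)\le -\xi$, where $\xi$ is the smallest negative solution of the polynomial equation $$(x+\delta)^{m-n}\mathcal{L}^{(-m-1)}_{n}(x)-(1-\eta)\binom{m}{n}\sum_{i=0}^{m-n}(-1)^{m-n-i}\,\frac{\binom{2m}{2i}\binom{m-n}{i}}{\binom{m}{i}}\,x^i\,\delta^{m-n-i}=0 .$$
   Context: For integers $0\le n\le m$, $\Pi_{m,n}$ is the class of polynomials $P(z)=\sum_{k=0}^m \alpha_k \frac{z^k}{k!}$ with $\alpha_0=\alpha_1=\dots=\alpha_n=1$; here real polynomials are considered. For real numbers $0\le\eta<1$, $\delta\ge 0$ and $P\in\Pi_{m,n}$, set $\ell(P,\eta,\delta)=\sup\{r>0 : |P(x)|\le 1-\eta \text{ for any } x\in[-r,-\delta]\}$. The optimal damped radius is $\ell_{m,n}(\eta,\delta)=\sup\{\ell(P,\eta,\delta) : P\in\Pi_{m,n}\}$. When $\delta=0$, the factor $\delta^{0}$ is read as $1$. For any real $\gamma$ (including negative values), the generalized Laguerre polynomial is defined by $\mathcal{L}_n^{(\gamma)}(x)=\sum_{\ell=0}^n\binom{n+\gamma}{n-\ell}\frac{(-x)^\ell}{\ell!}$, where $\binom{t}{\ell}=\frac{t(t-1)\cdots(t-\ell+1)}{\ell!}$ for $\ell>0$ and $\binom{t}{0}=1$.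
   Formalization: In ℓ(P,η,δ) only r ≥ δ is admitted, so that [-r,-δ] is nonempty (otherwise m=n=1, η=0, δ=5 is a counterexample); the bound is stated whenever ξ exists, and ξ is proved to exist whenever some r is admissible for some P (for m=n=2, η>1/2 there is no real solution). *)

theory Defs
  imports Complex_Main "HOL-Library.Extended_Real" "HOL-Computational_Algebra.Polynomial"
begin

definition exp_polys :: "nat \<Rightarrow> nat \<Rightarrow> real poly set" where
  "exp_polys m n =
     {P. \<exists>\<alpha> :: nat \<Rightarrow> real. (\<forall>k\<le>n. \<alpha> k = 1) \<and> P = (\<Sum>k\<le>m. monom (\<alpha> k / fact k) k)}"

text \<open>
  The supremum is taken in the extended reals: the supremum of the empty set is \<open>-\<infinity>\<close>, and a
  bound on it is never an artefact of unboundedness.  The condition \<open>\<delta> \<le> r\<close> says that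
  \<open>[-r, -\<delta>]\<close> is a genuine interval.  Without it every \<open>r\<close> with \<open>0 < r < \<delta>\<close> would be admissible
  for trivial reasons, and for \<open>m = n\<close> the polynomial bound would fail (e.g. \<open>m = n = 1\<close>, \<open>\<eta> = 0\<close>,
  \<open>\<delta> = 5\<close>, where the only polynomial is \<open>1 + x\<close> and the only root of the bounding equation
  is \<open>-2\<close>).
\<close>
definition damped_radius :: "real poly \<Rightarrow> real \<Rightarrow> real \<Rightarrow> ereal" where
  "damped_radius P \<eta> \<delta> =
     (SUP r \<in> {r. 0 < r \<and> \<delta> \<le> r \<and> (\<forall>x\<in>{-r..-\<delta>}. \<bar>poly P x\<bar> \<le> 1 - \<eta>)}. ereal r)"

definition optimal_damped_radius :: "nat \<Rightarrow> nat \<Rightarrow> real \<Rightarrow> real \<Rightarrow> ereal" where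
  "optimal_damped_radius m n \<eta> \<delta> = (SUP P \<in> exp_polys m n. damped_radius P \<eta> \<delta>)"

definition gen_laguerre :: "real \<Rightarrow> nat \<Rightarrow> real \<Rightarrow> real" where
  "gen_laguerre \<gamma> n x = (\<Sum>l\<le>n. ((real n + \<gamma>) gchoose (n - l)) * (-x) ^ l / fact l)"

definition bound_fun :: "nat \<Rightarrow> nat \<Rightarrow> real \<Rightarrow> real \<Rightarrow> real \<Rightarrow> real" where
  "bound_fun m n \<eta> \<delta> x =
     (x + \<delta>) ^ (m - n) * gen_laguerre (- real m - 1) n x
     - (1 - \<eta>) * real (m choose n) *
       (\<Sum>i=0..m - n. (-1) ^ (m - n - i)
          * (real ((2 * m) choose (2 * i)) * real ((m - n) choose i) / real (m choose i))
          * x ^ i * \<delta> ^ (m - n - i))"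

definition smallest_negative_solution :: "(real \<Rightarrow> real) \<Rightarrow> real \<Rightarrow> bool" where
  "smallest_negative_solution f \<xi> \<longleftrightarrow>
     \<xi> < 0 \<and> f \<xi> = 0 \<and> (\<forall>x. x < 0 \<and> f x = 0 \<longrightarrow> \<xi> \<le> x)"

end

theory Submission imports Defs
begin

text \<open>
  Let \<open>r\<close> be admissible for a polynomial \<open>P\<close>, and put \<open>a = - r\<close>, \<open>b = - \<delta>\<close>.  The constraint
  \<open>\<bar>P\<bar> \<le> 1 - \<eta>\<close> on \<open>[a, b]\<close> is compared with the fact that the derivatives of \<open>P\<close> at \<open>0\<close> up to
  order \<open>n\<close> are all \<open>1\<close>, through one linear functional.  With the homogenization
  \<open>P\<^sup>h(X, Y) = Y\<^sup>m P(X / Y)\<close>, let \<open>\<Lambda> P\<close> be the coefficient of \<open>e\<^sup>m\<^sup>-\<^sup>n\<close> in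
  \<open>P\<^sup>h(a, 1 + (b - a) e)\<close>.  In the language of blossoms this is, up to a constant, the polar form of
  \<open>P\<close> with \<open>m - n\<close> arguments equal to \<open>0\<close> and \<open>n\<close> arguments equal to \<open>a\<close>.  It sees only the first
  \<open>n + 1\<close> Taylor coefficients at \<open>0\<close>, and for \<open>P\<close> in the class it equals
  \<open>(b - a)\<^sup>m\<^sup>-\<^sup>n\<close> times the Laguerre polynomial at \<open>a\<close>, up to sign (\<open>coeff_homog_line\<close>,
  \<open>gen_laguerre_neg_parameter\<close>).

  Among polynomials of degree at most \<open>m\<close> bounded by \<open>M\<close> on \<open>[a, b]\<close>, the value \<open>\<bar>\<Lambda> P\<bar>\<close> is largest
  for \<open>M\<close> times the Chebyshev polynomial \<open>T\<close> of \<open>[a, b]\<close>.  Indeed, expand \<open>P\<close> by Lagrange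
  interpolation in the \<open>m + 1\<close> extremal points of \<open>T\<close>.  Homogenizing a Lagrange basis polynomial gives
  a product of linear factors \<open>(y - a) + y (b - a) e\<close> with \<open>y - a \<ge> 0 \<ge> y\<close>, so the sign of its
  coefficient of \<open>e\<^sup>m\<^sup>-\<^sup>n\<close> is the same whichever node is left out; the Lagrange denominators
  alternate in sign.  The weights of the interpolation formula for \<open>\<Lambda>\<close> therefore alternate along
  the nodes, exactly as the values of \<open>T\<close> do, and no cancellation occurs in \<open>\<Lambda> T\<close>
  (\<open>abs_linear_functional_le_equioscillating\<close>).  In powers of \<open>x - a\<close> and \<open>b - x\<close> the coefficients
  of \<open>T\<close> are signed binomials \<open>binom(2m, 2j)\<close>, and \<open>\<Lambda> T\<close> becomes, up to sign, the sum that
  the bounding equation multiplies by \<open>1 - \<eta>\<close> (\<open>coeff_homog_line_shifted_chebyshev\<close>).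

  Hence the bounding polynomial, normalized to have positive leading coefficient in \<open>r = - x\<close>, is
  \<open>\<le> 0\<close> at every admissible \<open>r\<close> (\<open>admissible_radius_bound_fun_le_0\<close>).  It tends to \<open>+\<infinity>\<close>, so it has
  a root in \<open>[r, \<infinity>)\<close>; consequently its largest positive root exists as soon as some \<open>r\<close> is
  admissible, and no admissible \<open>r\<close> exceeds it.
\<close>

section \<open>Functionals with alternating interpolation weights\<close>

lemma sign_prod_differences:
  fixes y :: "nat \<Rightarrow> real"
  assumes dec: "\<And>i j. i < j \<Longrightarrow> j \<le> m \<Longrightarrow> y j < y i" and k: "k \<le> m"
  shows "0 < (-1) ^ (m + k) * (\<Prod>i\<in>{..m} - {k}. y i - y k)"
proof -
  have split: "{..m} - {k} = {..<k} \<union> {k<..m}" using k by auto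
  have "(\<Prod>i\<in>{..m} - {k}. y i - y k) = (\<Prod>i<k. y i - y k) * (\<Prod>i\<in>{k<..m}. y i - y k)"
    unfolding split by (rule prod.union_disjoint) auto
  also have "(\<Prod>i\<in>{k<..m}. y i - y k) = (\<Prod>i\<in>{k<..m}. (-1) * (y k - y i))"
    by simp
  also have "\<dots> = (-1) ^ (m - k) * (\<Prod>i\<in>{k<..m}. y k - y i)"
    by (simp only: prod.distrib prod_constant) simp
  finally have eq: "(\<Prod>i\<in>{..m} - {k}. y i - y k)
      = (-1) ^ (m - k) * ((\<Prod>i<k. y i - y k) * (\<Prod>i\<in>{k<..m}. y k - y i))"
    by simp
  have sgn: "(-1) ^ (m + k) * (-1) ^ (m - k) = (1 :: real)"
    using k by (simp flip: power_add)
  have "0 < (\<Prod>i<k. y i - y k) * (\<Prod>i\<in>{k<..m}. y k - y i)"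
    using k by (intro mult_pos_pos prod_pos) (auto simp: dec)
  then show ?thesis
    unfolding eq by (simp only: mult.assoc[symmetric] sgn mult_1_left)
qed

text \<open>
  A discrete form of Chebyshev extremality.  In the interpolation formula
  \<open>\<Lambda> Q = (\<Sum>k\<le>m. Q (y k) * w k)\<close> the hypothesis \<open>sign\<close> makes the numerators of the weights have
  constant sign, whereas the denominators alternate with \<open>k\<close>.  So the terms \<open>T (y k) * w k = (-1)\<^sup>k * w k\<close>
  all have one sign: \<open>\<bar>\<Lambda> T\<bar>\<close> is the full sum of the \<open>\<bar>w k\<bar>\<close>, and \<open>M\<close> times this sum bounds
  \<open>\<bar>\<Lambda> P\<bar>\<close>.
\<close>
lemma abs_linear_functional_le_equioscillating:
  fixes \<Lambda> :: "real poly \<Rightarrow> real" and y :: "nat \<Rightarrow> real"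
  assumes add: "\<And>p q. \<Lambda> (p + q) = \<Lambda> p + \<Lambda> q"
    and scale: "\<And>c p. \<Lambda> (smult c p) = c * \<Lambda> p"
    and dec: "\<And>i j. i < j \<Longrightarrow> j \<le> m \<Longrightarrow> y j < y i"
    and sign: "\<And>k. k \<le> m \<Longrightarrow> 0 \<le> (-1) ^ s * \<Lambda> (\<Prod>i\<in>{..m} - {k}. [:y i, -1:])"
    and T: "degree T \<le> m" "\<And>k. k \<le> m \<Longrightarrow> poly T (y k) = (-1) ^ k"
    and P: "degree P \<le> m" "\<And>k. k \<le> m \<Longrightarrow> \<bar>poly P (y k)\<bar> \<le> M"
  shows "\<bar>\<Lambda> P\<bar> \<le> M * \<bar>\<Lambda> T\<bar>"
proof -
  define L where "L k = (\<Prod>i\<in>{..m} - {k}. [:y i, -1:])" for k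
  define D where "D k = (\<Prod>i\<in>{..m} - {k}. y i - y k)" for k
  define w where "w k = \<Lambda> (L k) / D k" for k
  have D: "0 < (-1) ^ (m + k) * D k" if "k \<le> m" for k
    unfolding D_def by (rule sign_prod_differences) (use dec that in auto)
  have inj: "inj_on y {..m}"
    by (rule inj_onI) (metis atMost_iff dec less_irrefl linorder_neqE_nat)
  have degL: "degree (L k) \<le> m" if "k \<le> m" for k
  proof -
    have "degree (L k) \<le> sum (degree \<circ> (\<lambda>i. [:y i, -1:])) ({..m} - {k})"
      unfolding L_def by (rule degree_prod_sum_le) simp
    also have "\<dots> = m" using that by simp
    finally show ?thesis .
  qed
  have zero: "\<Lambda> 0 = 0" using scale[of 0 0] by simp
  have sums: "\<Lambda> (sum f A) = (\<Sum>k\<in>A. \<Lambda> (f k))" if "finite A" for f and A :: "nat set"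
    using that by (induction A) (auto simp: add zero)
  have interpolation: "\<Lambda> Q = (\<Sum>k\<le>m. poly Q (y k) * w k)" if Q: "degree Q \<le> m" for Q
  proof -
    have "Q = (\<Sum>k\<le>m. smult (poly Q (y k) / D k) (L k))" (is "Q = ?R")
    proof (rule poly_eqI_degree[where A = "y ` {..m}"])
      fix x assume "x \<in> y ` {..m}"
      then obtain l where l: "l \<le> m" "x = y l" by auto
      have L: "poly (L k) (y l) = (if k = l then D l else 0)" for k
        using l(1) unfolding L_def D_def by (auto simp: poly_prod)
      have "D l \<noteq> 0" using D[OF l(1)] by auto
      then show "poly Q x = poly ?R x"
        using l by (simp add: poly_sum L if_distrib sum.delta cong: if_cong)
    next
      have card: "card (y ` {..m}) = Suc m" using inj by (simp add: card_image)
      show "degree Q < card (y ` {..m})" using Q card by simp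
      have "degree ?R \<le> m"
        by (rule degree_sum_le) (use degL in \<open>auto intro: order.trans[OF degree_smult_le]\<close>)
      then show "degree ?R < card (y ` {..m})" using card by simp
    qed
    then have "\<Lambda> Q = \<Lambda> ?R" by simp
    then show ?thesis by (simp add: sums scale w_def)
  qed
  have abs_w: "\<bar>w k\<bar> = (-1) ^ (s + m) * ((-1) ^ k * w k)" if k: "k \<le> m" for k
  proof -
    have "(-1) ^ (s + m) * ((-1) ^ k * w k)
        = ((-1) ^ s * \<Lambda> (L k)) / ((-1) ^ (m + k) * D k)"
      by (simp add: w_def power_add minus_one_power_iff)
    also have "\<dots> \<ge> 0" using D[OF k] sign[OF k] by (simp add: L_def)
    finally have "0 \<le> (-1) ^ (s + m) * ((-1) ^ k * w k)" .
    then show ?thesis by (auto simp: minus_one_power_iff split: if_splits)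
  qed
  have "\<bar>\<Lambda> P\<bar> \<le> (\<Sum>k\<le>m. \<bar>poly P (y k) * w k\<bar>)"
    unfolding interpolation[OF P(1)] by (rule sum_abs)
  also have "\<dots> \<le> (\<Sum>k\<le>m. M * \<bar>w k\<bar>)"
    by (rule sum_mono) (use P(2) in \<open>auto simp: abs_mult intro: mult_right_mono\<close>)
  also have "\<dots> = M * (\<Sum>k\<le>m. (-1) ^ (s + m) * ((-1) ^ k * w k))"
    by (simp add: abs_w sum_distrib_left)
  also have "(\<Sum>k\<le>m. (-1) ^ (s + m) * ((-1) ^ k * w k)) = (-1) ^ (s + m) * \<Lambda> T"
    unfolding interpolation[OF T(1)] sum_distrib_left using T(2) by (intro sum.cong) auto
  finally have "\<bar>\<Lambda> P\<bar> \<le> M * ((-1) ^ (s + m) * \<Lambda> T)" .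
  moreover have "0 \<le> M" using P(2)[of 0] by auto
  moreover have "(-1) ^ (s + m) * \<Lambda> T \<le> \<bar>\<Lambda> T\<bar>"
    by (cases "even (s + m)") auto
  ultimately show ?thesis
    by (meson mult_left_mono order.trans)
qed

section \<open>The homogenized polynomial on a line\<close>

text \<open>
  With \<open>P\<^sup>h(X, Y) = (\<Sum>k\<le>m. coeff P k * X\<^sup>k * Y\<^sup>m\<^sup>-\<^sup>k)\<close>, this is \<open>P\<^sup>h(a, 1 + d e)\<close> as a polynomial
  in \<open>e\<close>.
\<close>
definition homog_line :: "nat \<Rightarrow> real \<Rightarrow> real \<Rightarrow> real poly \<Rightarrow> real poly" where
  "homog_line m a d P = (\<Sum>k\<le>m. smult (coeff P k * a ^ k) ([:1, d:] ^ (m - k)))"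

lemma homog_line_add: "homog_line m a d (p + q) = homog_line m a d p + homog_line m a d q"
  by (simp add: homog_line_def smult_add_left ring_distribs sum.distrib)

lemma homog_line_smult: "homog_line m a d (smult c p) = smult c (homog_line m a d p)"
  unfolding homog_line_def poly_eq_iff by (simp add: coeff_sum sum_distrib_left mult.assoc)

lemma poly_homog_line:
  assumes "degree P \<le> m" and "1 + d * e \<noteq> 0"
  shows "poly (homog_line m a d P) e = (1 + d * e) ^ m * poly P (a / (1 + d * e))"
proof -
  have "poly P (a / (1 + d * e)) = (\<Sum>k\<le>m. coeff P k * (a / (1 + d * e)) ^ k)"
    unfolding poly_altdef using assms(1)
    by (intro sum.mono_neutral_left) (auto simp: coeff_eq_0)
  moreover have "(1 + d * e) ^ m * (a / (1 + d * e)) ^ k = a ^ k * (1 + d * e) ^ (m - k)"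
    if "k \<le> m" for k
    using assms(2) that by (simp add: power_divide power_diff)
  ultimately show ?thesis
    by (auto simp: homog_line_def poly_sum poly_power sum_distrib_left algebra_simps intro!: sum.cong)
qed

text \<open>
  Homogenization is multiplicative on factors whose degrees are tracked exactly; comparing values for
  \<open>e > 0\<close>, where \<open>1 + d e\<close> cannot vanish, replaces that bookkeeping.
\<close>
lemma homog_line_eqI:
  assumes "degree P \<le> m" and "0 \<le> d"
    and "\<And>e. 0 < e \<Longrightarrow> poly Q e = (1 + d * e) ^ m * poly P (a / (1 + d * e))"
  shows "homog_line m a d P = Q"
proof (rule ccontr)
  assume "homog_line m a d P \<noteq> Q"
  then have "finite {x. poly (homog_line m a d P - Q) x = 0}"
    by (intro poly_roots_finite) simp
  moreover have "{0<..} \<subseteq> {x. poly (homog_line m a d P - Q) x = 0}"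
  proof
    fix e :: real assume "e \<in> {0<..}"
    then have "0 < e" by simp
    then have "0 < 1 + d * e" using assms(2) by (intro add_pos_nonneg) auto
    then show "e \<in> {x. poly (homog_line m a d P - Q) x = 0}"
      using \<open>0 < e\<close> assms by (simp add: poly_homog_line)
  qed
  ultimately show False
    using infinite_Ioi[of "0 :: real"] finite_subset by blast
qed

text \<open>
  A term with \<open>k > n\<close> carries the factor \<open>(1 + d e)\<^sup>m\<^sup>-\<^sup>k\<close>, of degree below \<open>m - n\<close>.  So this coefficient
  depends only on the Taylor coefficients prescribed by the class.
\<close>
lemma coeff_homog_line:
  assumes "n \<le> m"
  shows "coeff (homog_line m a d P) (m - n)
           = d ^ (m - n) * (\<Sum>k\<le>n. real ((m - k) choose (n - k)) * coeff P k * a ^ k)"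
proof -
  have c: "coeff ([:1, d:] ^ N) i = real (N choose i) * d ^ i" for N i
  proof (cases "i \<le> N")
    case True
    then show ?thesis by (simp add: coeff_linear_poly_power)
  next
    case False
    moreover have "degree ([:1, d:] ^ N) \<le> N"
      using degree_power_le[of "[:1, d:]" N] by (auto split: if_splits)
    ultimately show ?thesis by (simp add: coeff_eq_0)
  qed
  have "coeff (homog_line m a d P) (m - n)
      = (\<Sum>k\<le>m. coeff P k * a ^ k * (real ((m - k) choose (m - n)) * d ^ (m - n)))"
    by (simp add: homog_line_def coeff_sum c)
  also have "\<dots> = (\<Sum>k\<le>n. coeff P k * a ^ k * (real ((m - k) choose (m - n)) * d ^ (m - n)))"
    by (rule sum.mono_neutral_right) (use assms in auto)
  also have "\<dots> = (\<Sum>k\<le>n. d ^ (m - n) * (real ((m - k) choose (n - k)) * coeff P k * a ^ k))"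
  proof (rule sum.cong[OF refl])
    fix k assume "k \<in> {..n}"
    then have "(m - k) choose (m - n) = (m - k) choose (n - k)"
      using assms by (subst binomial_symmetric) auto
    then show "coeff P k * a ^ k * (real ((m - k) choose (m - n)) * d ^ (m - n))
        = d ^ (m - n) * (real ((m - k) choose (n - k)) * coeff P k * a ^ k)"
      by simp
  qed
  finally show ?thesis by (simp add: sum_distrib_left)
qed

lemma alternating_coeff_prod:
  fixes p q :: "'i \<Rightarrow> real"
  assumes "finite I" and "\<And>i. i \<in> I \<Longrightarrow> 0 \<le> p i" and "\<And>i. i \<in> I \<Longrightarrow> q i \<le> 0"
  shows "0 \<le> (-1) ^ j * coeff (\<Prod>i\<in>I. [:p i, q i:]) j"
  using assms
proof (induction I arbitrary: j rule: finite_induct)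
  case empty
  then show ?case by (cases j) (auto simp: coeff_1)
next
  case (insert x I)
  define R where "R = (\<Prod>i\<in>I. [:p i, q i:])"
  have IH: "0 \<le> (-1) ^ j * coeff R j" for j
    unfolding R_def by (rule insert.IH) (use insert.prems in auto)
  have 1: "0 \<le> p x * ((-1) ^ j * coeff R j)"
    by (rule mult_nonneg_nonneg[OF _ IH]) (simp add: insert.prems)
  have 2: "0 \<le> (- q x) * ((-1) ^ i * coeff R i)" for i
    by (rule mult_nonneg_nonneg[OF _ IH]) (simp add: insert.prems)
  have "(\<Prod>i\<in>insert x I. [:p i, q i:]) = smult (p x) R + pCons 0 (smult (q x) R)"
    using insert by (simp add: R_def)
  then have "(-1) ^ j * coeff (\<Prod>i\<in>insert x I. [:p i, q i:]) j
      = p x * ((-1) ^ j * coeff R j) + (case j of 0 \<Rightarrow> 0 | Suc i \<Rightarrow> - q x * ((-1) ^ i * coeff R i))"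
    by (cases j) (simp_all add: algebra_simps)
  then show ?case
    using 1 2 by (auto split: nat.split)
qed

section \<open>The Chebyshev polynomial of an interval\<close>

text \<open>
  The real part of de Moivre's formula \<open>(cos t + \<i> sin t)\<^sup>2\<^sup>m\<close>: only the even powers of \<open>cos t\<close>
  contribute, which is where the binomials \<open>binom(2m, 2j)\<close> come from.
\<close>
lemma cos_even_multiple_expansion:
  "cos (2 * real m * t)
     = (\<Sum>j\<le>m. (-1) ^ (m - j) * real ((2 * m) choose (2 * j)) * (cos t ^ 2) ^ j * (sin t ^ 2) ^ (m - j))"
proof -
  define f where "f i = of_nat ((2 * m) choose i) * complex_of_real (cos t) ^ i
                          * (\<i> * complex_of_real (sin t)) ^ (2 * m - i)" for i
  have "cos (2 * real m * t) = Re (cis t ^ (2 * m))"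
    by (simp add: DeMoivre)
  also have "cis t ^ (2 * m) = (\<Sum>i\<le>2 * m. f i)"
  proof -
    have "cis t = complex_of_real (cos t) + \<i> * complex_of_real (sin t)"
      by (simp add: complex_eq_iff)
    then show ?thesis by (simp only: binomial_ring f_def)
  qed
  also have "\<dots> = (\<Sum>i\<le>Suc (2 * m). f i)"
    by (simp add: f_def)
  \<comment> \<open>The added term \<open>i = 2 * m + 1\<close> has binomial coefficient \<open>0\<close>, so the range splits into pairs.\<close>
  also have "\<dots> = (\<Sum>j\<le>m. f (2 * j) + f (Suc (2 * j)))"
    by (rule sum.in_pairs_0)
  also have "Re \<dots> = (\<Sum>j\<le>m. Re (f (2 * j)) + Re (f (Suc (2 * j))))"
    by simp
  also have "\<dots> = (\<Sum>j\<le>m. (-1) ^ (m - j) * real ((2 * m) choose (2 * j)) * (cos t ^ 2) ^ j * (sin t ^ 2) ^ (m - j))"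
  proof (rule sum.cong[OF refl])
    fix j assume "j \<in> {..m}"
    then have j: "j \<le> m" by simp
    have "f (2 * j) = of_nat ((2 * m) choose (2 * j)) * (complex_of_real (cos t) ^ 2) ^ j
                        * ((\<i> * complex_of_real (sin t)) ^ 2) ^ (m - j)"
      by (simp add: f_def power_mult[symmetric] right_diff_distrib')
    also have "\<dots> = complex_of_real (real ((2 * m) choose (2 * j)) * (cos t ^ 2) ^ j * (- (sin t ^ 2)) ^ (m - j))"
      by (simp add: power_mult_distrib)
    finally have even: "Re (f (2 * j)) = (-1) ^ (m - j) * real ((2 * m) choose (2 * j)) * (cos t ^ 2) ^ j * (sin t ^ 2) ^ (m - j)"
      by (simp only: Re_complex_of_real power_minus[of "sin t ^ 2"]) (simp add: mult_ac)
    have odd: "Re (f (Suc (2 * j))) = 0"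
    proof (cases "j = m")
      case True
      then show ?thesis by (simp add: f_def)
    next
      case False
      then have e: "2 * m - Suc (2 * j) = Suc (2 * (m - j - 1))" using j by simp
      have "f (Suc (2 * j)) = of_nat ((2 * m) choose Suc (2 * j)) * complex_of_real (cos t) ^ Suc (2 * j)
              * ((\<i> * complex_of_real (sin t)) * ((\<i> * complex_of_real (sin t)) ^ 2) ^ (m - j - 1))"
        by (simp add: f_def e power_mult[symmetric])
      also have "\<dots> = \<i> * complex_of_real (real ((2 * m) choose Suc (2 * j)) * cos t ^ Suc (2 * j)
              * (sin t * (- (sin t ^ 2)) ^ (m - j - 1)))"
        by (simp add: power_mult_distrib)
      finally show ?thesis by (simp only: Re_i_times Im_complex_of_real neg_equal_zero minus_zero)
    qed
    show "Re (f (2 * j)) + Re (f (Suc (2 * j))) = (-1) ^ (m - j) * real ((2 * m) choose (2 * j)) * (cos t ^ 2) ^ j * (sin t ^ 2) ^ (m - j)"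
      using even odd by simp
  qed
  finally show ?thesis .
qed

text \<open>
  The Chebyshev polynomial of degree \<open>m\<close> transported to \<open>[a, b]\<close>, written in the powers of \<open>x - a\<close> and
  \<open>b - x\<close> so that substituting \<open>x = a sin\<^sup>2 t + b cos\<^sup>2 t\<close> gives \<open>cos (2 m t)\<close>.
\<close>
definition shifted_chebyshev :: "nat \<Rightarrow> real \<Rightarrow> real \<Rightarrow> real poly" where
  "shifted_chebyshev m a b =
     (\<Sum>j\<le>m. smult ((-1) ^ (m - j) * real ((2 * m) choose (2 * j)) / (b - a) ^ m)
        ([:- a, 1:] ^ j * [:b, - 1:] ^ (m - j)))"

lemma degree_shifted_chebyshev: "degree (shifted_chebyshev m a b) \<le> m"
  unfolding shifted_chebyshev_def
proof (rule degree_sum_le)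
  fix j assume "j \<in> {..m}"
  then have j: "j \<le> m" by simp
  have "degree ([:- a, 1:] ^ j * [:b, - 1:] ^ (m - j)) \<le> degree ([:- a, 1:] ^ j) + degree ([:b, - 1:] ^ (m - j))"
    by (rule degree_mult_le)
  also have "\<dots> \<le> 1 * j + 1 * (m - j)"
    by (rule add_mono; rule order.trans[OF degree_power_le]) auto
  finally show "degree (smult ((-1) ^ (m - j) * real ((2 * m) choose (2 * j)) / (b - a) ^ m)
        ([:- a, 1:] ^ j * [:b, - 1:] ^ (m - j))) \<le> m"
    using j by (intro order.trans[OF degree_smult_le]) simp
qed simp

lemma poly_shifted_chebyshev:
  assumes "a \<noteq> b" and "u + v = 1"
  shows "poly (shifted_chebyshev m a b) (a * u + b * v)
           = (\<Sum>j\<le>m. (-1) ^ (m - j) * real ((2 * m) choose (2 * j)) * v ^ j * u ^ (m - j))"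
proof -
  have u: "u = 1 - v" using assms(2) by simp
  have 1: "a * u + b * v - a = (b - a) * v" unfolding u by (simp add: algebra_simps)
  have 2: "b - (a * u + b * v) = (b - a) * u" unfolding u by (simp add: algebra_simps)
  have "poly (shifted_chebyshev m a b) (a * u + b * v)
      = (\<Sum>j\<le>m. (-1) ^ (m - j) * real ((2 * m) choose (2 * j)) / (b - a) ^ m
          * ((a * u + b * v - a) ^ j * (b - (a * u + b * v)) ^ (m - j)))"
    by (simp add: shifted_chebyshev_def poly_sum poly_power algebra_simps)
  also have "\<dots> = (\<Sum>j\<le>m. (-1) ^ (m - j) * real ((2 * m) choose (2 * j)) * v ^ j * u ^ (m - j))"
  proof (rule sum.cong[OF refl])
    fix j assume "j \<in> {..m}"
    then have "(b - a) ^ j * (b - a) ^ (m - j) = (b - a) ^ m"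
      by (simp flip: power_add)
    then have "((b - a) * v) ^ j * ((b - a) * u) ^ (m - j) = (b - a) ^ m * (v ^ j * u ^ (m - j))"
      unfolding power_mult_distrib by (metis mult.assoc mult.left_commute)
    then show "(-1) ^ (m - j) * real ((2 * m) choose (2 * j)) / (b - a) ^ m
          * ((a * u + b * v - a) ^ j * (b - (a * u + b * v)) ^ (m - j))
        = (-1) ^ (m - j) * real ((2 * m) choose (2 * j)) * v ^ j * u ^ (m - j)"
      unfolding 1 2 using assms(1) by simp
  qed
  finally show ?thesis .
qed

text \<open>
  With \<open>Y = 1 + (b - a) e\<close>, the linear forms \<open>X - a Y\<close> and \<open>b Y - X\<close> restrict at \<open>X = a\<close> to
  \<open>(b - a) (- a e)\<close> and \<open>(b - a) (1 + b e)\<close>.  Their powers multiply to a monomial times a binomial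
  power, so that each summand of the Chebyshev polynomial contributes one binomial coefficient.
\<close>
lemma coeff_homog_line_shifted_chebyshev:
  assumes "a < b" and "n \<le> m"
  shows "coeff (homog_line m a (b - a) (shifted_chebyshev m a b)) (m - n)
     = (-1) ^ n * (\<Sum>j\<le>m - n. real ((2 * m) choose (2 * j)) * real ((m - j) choose n) * (- a) ^ j * (- b) ^ (m - n - j))"
proof -
  have "homog_line m a (b - a) (shifted_chebyshev m a b)
      = (\<Sum>j\<le>m. smult ((-1) ^ (m - j) * real ((2 * m) choose (2 * j))) (monom ((- a) ^ j) j * [:1, b:] ^ (m - j)))"
    (is "_ = ?Q")
  proof (rule homog_line_eqI)
    fix e :: real assume e: "0 < e"
    define y where "y = 1 + (b - a) * e"
    have y: "0 < y" unfolding y_def using e assms by (intro add_pos_nonneg) auto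
    have node: "a / y = a * ((1 + b * e) / y) + b * (- a * e / y)"
      using y by (simp add: field_simps) 
    have "(1 + b * e) / y + - a * e / y = 1"
      using y by (simp add: field_simps) (simp add: y_def algebra_simps)
    then have "poly (shifted_chebyshev m a b) (a / y)
       = (\<Sum>j\<le>m. (-1) ^ (m - j) * real ((2 * m) choose (2 * j)) * (- a * e / y) ^ j * ((1 + b * e) / y) ^ (m - j))"
      unfolding node using assms by (intro poly_shifted_chebyshev) auto
    then have "y ^ m * poly (shifted_chebyshev m a b) (a / y)
       = (\<Sum>j\<le>m. y ^ m * ((-1) ^ (m - j) * real ((2 * m) choose (2 * j)) * (- a * e / y) ^ j * ((1 + b * e) / y) ^ (m - j)))"
      by (simp add: sum_distrib_left)
    also have "\<dots> = poly ?Q e"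
      unfolding poly_sum
    proof (rule sum.cong[OF refl])
      fix j assume "j \<in> {..m}"
      then have "y ^ m = y ^ j * y ^ (m - j)" by (simp flip: power_add)
      moreover have "y ^ j * (- a * e / y) ^ j = (- a * e) ^ j"
        and "y ^ (m - j) * ((1 + b * e) / y) ^ (m - j) = (1 + b * e) ^ (m - j)"
        using y by (simp_all flip: power_mult_distrib)
      ultimately have "y ^ m * ((- a * e / y) ^ j * ((1 + b * e) / y) ^ (m - j)) = (- a * e) ^ j * (1 + b * e) ^ (m - j)"
        by (metis mult.assoc mult.left_commute)
      then show "y ^ m * ((-1) ^ (m - j) * real ((2 * m) choose (2 * j)) * (- a * e / y) ^ j * ((1 + b * e) / y) ^ (m - j))
         = poly (smult ((-1) ^ (m - j) * real ((2 * m) choose (2 * j))) (monom ((- a) ^ j) j * [:1, b:] ^ (m - j))) e"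
        by (simp add: poly_monom poly_power power_mult_distrib[symmetric] mult_ac)
    qed
    finally show "poly ?Q e = (1 + (b - a) * e) ^ m * poly (shifted_chebyshev m a b) (a / (1 + (b - a) * e))"
      by (simp add: y_def)
  qed (use assms degree_shifted_chebyshev in auto)
  then have "coeff (homog_line m a (b - a) (shifted_chebyshev m a b)) (m - n)
      = (\<Sum>j\<le>m. (-1) ^ (m - j) * real ((2 * m) choose (2 * j))
           * (if m - n < j then 0 else (- a) ^ j * coeff ([:1, b:] ^ (m - j)) (m - n - j)))"
    by (simp add: coeff_sum coeff_monom_mult)
  also have "\<dots> = (\<Sum>j\<le>m - n. (-1) ^ (m - j) * real ((2 * m) choose (2 * j))
           * (if m - n < j then 0 else (- a) ^ j * coeff ([:1, b:] ^ (m - j)) (m - n - j)))"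
    by (rule sum.mono_neutral_right) auto
  also have "\<dots> = (\<Sum>j\<le>m - n. (-1) ^ n * (real ((2 * m) choose (2 * j)) * real ((m - j) choose n) * (- a) ^ j * (- b) ^ (m - n - j)))"
  proof (rule sum.cong[OF refl])
    fix j assume "j \<in> {..m - n}"
    then have j: "j \<le> m - n" by simp
    have bin: "(m - j) choose (m - n - j) = (m - j) choose n"
      using j assms by (subst binomial_symmetric) auto
    have "m - j = n + (m - n - j)" using j assms by simp
    then have sgn: "(-1) ^ (m - j) = (-1 :: real) ^ n * (-1) ^ (m - n - j)"
      by (simp flip: power_add)
    show "(-1) ^ (m - j) * real ((2 * m) choose (2 * j))
           * (if m - n < j then 0 else (- a) ^ j * coeff ([:1, b:] ^ (m - j)) (m - n - j))
        = (-1) ^ n * (real ((2 * m) choose (2 * j)) * real ((m - j) choose n) * (- a) ^ j * (- b) ^ (m - n - j))"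
      using j bin unfolding sgn power_minus[of b]
      by (simp add: coeff_linear_poly_power)
  qed
  finally show ?thesis by (simp add: sum_distrib_left)
qed

section \<open>Bounding the prescribed Taylor coefficients\<close>

lemma coeff_exp_polys:
  assumes "P \<in> exp_polys m n" and "k \<le> n" and "n \<le> m"
  shows "coeff P k = 1 / fact k"
proof -
  obtain \<alpha> :: "nat \<Rightarrow> real" where \<alpha>: "\<forall>k\<le>n. \<alpha> k = 1" "P = (\<Sum>k\<le>m. monom (\<alpha> k / fact k) k)"
    using assms(1) by (auto simp: exp_polys_def)
  then show ?thesis
    using assms by (simp add: coeff_sum sum.delta')
qed

lemma degree_exp_polys: "P \<in> exp_polys m n \<Longrightarrow> degree P \<le> m"
  by (auto simp: exp_polys_def intro!: degree_sum_le order.trans[OF degree_monom_le])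

text \<open>
  The extremal principle applied to the coefficient functional, with the Chebyshev nodes
  \<open>a sin\<^sup>2 \<theta> + b cos\<^sup>2 \<theta>\<close> for \<open>\<theta> = k \<pi> / (2 m)\<close>, at which the Chebyshev polynomial is \<open>(-1)\<^sup>k\<close>.  The
  condition \<open>b \<le> 0\<close> puts all nodes in \<open>[a, 0]\<close>, which forces the sign pattern of the weights.
\<close>
lemma exp_polys_jet_bound:
  assumes P: "P \<in> exp_polys m n" and nm: "0 < n" "n \<le> m" and ab: "a < b" "b \<le> 0"
    and bounded: "\<And>x. x \<in> {a..b} \<Longrightarrow> \<bar>poly P x\<bar> \<le> M"
  shows "(b - a) ^ (m - n) * \<bar>\<Sum>k\<le>n. real ((m - k) choose (n - k)) * a ^ k / fact k\<bar>
     \<le> M * (\<Sum>j\<le>m - n. real ((2 * m) choose (2 * j)) * real ((m - j) choose n) * (- a) ^ j * (- b) ^ (m - n - j))"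
proof -
  define \<Lambda> where "\<Lambda> Q = coeff (homog_line m a (b - a) Q) (m - n)" for Q
  define \<theta> where "\<theta> k = real k * pi / (2 * real m)" for k
  define y where "y k = a * (sin (\<theta> k))\<^sup>2 + b * (cos (\<theta> k))\<^sup>2" for k
  define T where "T = shifted_chebyshev m a b"
  have m: "0 < m" using nm by simp
  have \<theta>_range: "0 \<le> \<theta> k" "\<theta> k \<le> pi / 2" if "k \<le> m" for k
    using that m by (auto simp: \<theta>_def field_simps)
  have cos_nonneg: "0 \<le> cos (\<theta> k)" if "k \<le> m" for k
    using \<theta>_range[OF that] by (intro cos_ge_zero) auto
  have y_eq: "y k = a + (b - a) * (cos (\<theta> k))\<^sup>2" for k
    by (simp add: y_def sin_squared_eq algebra_simps)
  have y_eq': "y k = b - (b - a) * (sin (\<theta> k))\<^sup>2" for k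
    by (simp add: y_def cos_squared_eq algebra_simps)
  have y_range: "y k \<in> {a..b}" for k
  proof -
    have "a \<le> y k" using ab by (simp add: y_eq)
    moreover have "y k \<le> b" using ab by (simp add: y_eq')
    ultimately show ?thesis by simp
  qed
  have y_dec: "y j < y i" if "i < j" "j \<le> m" for i j
  proof -
    have "\<theta> i < \<theta> j" using that m by (simp add: \<theta>_def divide_strict_right_mono)
    then have "cos (\<theta> j) < cos (\<theta> i)"
      using \<theta>_range[of i] \<theta>_range[of j] that pi_gt_zero by (intro cos_monotone_0_pi) auto
    then have "(cos (\<theta> j))\<^sup>2 < (cos (\<theta> i))\<^sup>2"
      using cos_nonneg[OF that(2)] by (intro power_strict_mono) auto
    then show ?thesis using ab by (simp add: y_eq)
  qed
  \<comment> \<open>Each factor \<open>y - x\<close> homogenizes to \<open>y Y - X = (y - a) + y (b - a) e\<close>, with signs \<open>+\<close> and \<open>-\<close>.\<close>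
  have sign: "0 \<le> (-1) ^ (m - n) * \<Lambda> (\<Prod>i\<in>{..m} - {k}. [:y i, -1:])" if k: "k \<le> m" for k
  proof -
    have "homog_line m a (b - a) (\<Prod>i\<in>{..m} - {k}. [:y i, -1:])
        = (\<Prod>i\<in>{..m} - {k}. [:y i - a, y i * (b - a):])"
    proof (rule homog_line_eqI)
      have "degree (\<Prod>i\<in>{..m} - {k}. [:y i, -1:]) \<le> sum (degree \<circ> (\<lambda>i. [:y i, -1:])) ({..m} - {k})"
        by (rule degree_prod_sum_le) simp
      also have "\<dots> = m" using k by simp
      finally show "degree (\<Prod>i\<in>{..m} - {k}. [:y i, -1:]) \<le> m" .
    next
      fix e :: real assume e: "0 < e"
      define Y where "Y = 1 + (b - a) * e"
      have "0 < Y" unfolding Y_def using e ab by (intro add_pos_nonneg) auto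
      then have factor: "y i - a + e * (y i * (b - a)) = Y * (y i - a / Y)" for i
        by (simp add: field_simps) (simp add: Y_def algebra_simps)
      have "card ({..m} - {k}) = m" using k by simp
      then show "poly (\<Prod>i\<in>{..m} - {k}. [:y i - a, y i * (b - a):]) e
          = (1 + (b - a) * e) ^ m * poly (\<Prod>i\<in>{..m} - {k}. [:y i, -1:]) (a / (1 + (b - a) * e))"
        unfolding Y_def[symmetric] by (simp add: poly_prod factor prod.distrib)
    qed (use ab in simp)
    moreover have "0 \<le> y i - a" and "y i * (b - a) \<le> 0" for i
      using y_range[of i] ab by (auto intro!: mult_nonpos_nonneg)
    ultimately show ?thesis
      unfolding \<Lambda>_def by (simp only:) (rule alternating_coeff_prod, auto)
  qed
  have T_nodes: "poly T (y k) = (-1) ^ k" if "k \<le> m" for k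
  proof -
    have "poly T (y k) = cos (2 * real m * \<theta> k)"
      unfolding T_def y_def cos_even_multiple_expansion
      using ab by (intro poly_shifted_chebyshev) auto
    also have "2 * real m * \<theta> k = real k * pi" using m by (simp add: \<theta>_def)
    finally show ?thesis by simp
  qed
  have "\<bar>\<Lambda> P\<bar> \<le> M * \<bar>\<Lambda> T\<bar>"
  proof (rule abs_linear_functional_le_equioscillating[where y = y and m = m and s = "m - n"])
    show "degree T \<le> m" unfolding T_def by (rule degree_shifted_chebyshev)
    show "degree P \<le> m" using P by (rule degree_exp_polys)
  qed (use sign y_dec T_nodes bounded y_range in \<open>auto simp: \<Lambda>_def homog_line_add homog_line_smult\<close>)
  moreover have "\<Lambda> P = (b - a) ^ (m - n) * (\<Sum>k\<le>n. real ((m - k) choose (n - k)) * a ^ k / fact k)"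
    unfolding \<Lambda>_def coeff_homog_line[OF nm(2)]
    by (simp add: coeff_exp_polys[OF P _ nm(2)])
  moreover have "\<bar>\<Lambda> T\<bar> = (\<Sum>j\<le>m - n. real ((2 * m) choose (2 * j)) * real ((m - j) choose n) * (- a) ^ j * (- b) ^ (m - n - j))"
    unfolding \<Lambda>_def T_def coeff_homog_line_shifted_chebyshev[OF ab(1) nm(2)] abs_mult power_abs
    using ab by (simp add: sum_nonneg)
  ultimately show ?thesis using ab by (simp add: abs_mult)
qed

section \<open>The bounding polynomial\<close>

lemma gen_laguerre_neg_parameter:
  assumes "n \<le> m"
  shows "gen_laguerre (- real m - 1) n x
           = (-1) ^ n * (\<Sum>k\<le>n. real ((m - k) choose (n - k)) * x ^ k / fact k)"
  unfolding gen_laguerre_def sum_distrib_left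
proof (rule sum.cong[OF refl])
  fix k assume "k \<in> {..n}"
  then have k: "k \<le> n" by simp
  have "real n + (- real m - 1) gchoose (n - k)
      = (-1) ^ (n - k) * (real (n - k) - (real n + (- real m - 1)) - 1 gchoose (n - k))"
    by (rule gbinomial_negated_upper)
  also have "real (n - k) - (real n + (- real m - 1)) - 1 = real (m - k)"
    using k assms by simp
  also have "(real (m - k) gchoose (n - k)) = real ((m - k) choose (n - k))"
    by (simp add: binomial_gbinomial)
  finally have "real n + (- real m - 1) gchoose (n - k) = (-1) ^ (n - k) * real ((m - k) choose (n - k))" .
  moreover have "(-1 :: real) ^ n = (-1) ^ (n - k) * (-1) ^ k"
    using k by (simp flip: power_add)
  ultimately show "(real n + (- real m - 1) gchoose (n - k)) * (- x) ^ k / fact k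
      = (-1) ^ n * (real ((m - k) choose (n - k)) * x ^ k / fact k)"
    by (simp add: power_minus[of x])
qed

text \<open>
  Both the Laguerre part and the Chebyshev part carry the sign \<open>(-1)\<^sup>m\<^sup>-\<^sup>n\<close> after \<open>x = - r\<close>; factoring
  it out leaves exactly the two sides of the inequality for the prescribed Taylor coefficients.
\<close>
lemma bound_fun_uminus:
  assumes "n \<le> m"
  shows "bound_fun m n \<eta> \<delta> (- r) = (-1) ^ (m - n) *
     ((r - \<delta>) ^ (m - n) * ((-1) ^ n * (\<Sum>k\<le>n. real ((m - k) choose (n - k)) * (- r) ^ k / fact k))
      - (1 - \<eta>) * (\<Sum>j\<le>m - n. real ((2 * m) choose (2 * j)) * real ((m - j) choose n) * r ^ j * \<delta> ^ (m - n - j)))"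
proof -
  have "real (m choose n) *
       (\<Sum>i=0..m - n. (-1) ^ (m - n - i)
          * (real ((2 * m) choose (2 * i)) * real ((m - n) choose i) / real (m choose i))
          * (- r) ^ i * \<delta> ^ (m - n - i))
     = (-1) ^ (m - n) * (\<Sum>j\<le>m - n. real ((2 * m) choose (2 * j)) * real ((m - j) choose n) * r ^ j * \<delta> ^ (m - n - j))"
    unfolding sum_distrib_left atMost_atLeast0
  proof (rule sum.cong[OF refl])
    fix i assume "i \<in> {0..m - n}"
    then have i: "i \<le> m - n" by simp
    have "(m choose n) * ((m - n) choose i) = (m choose (n + i)) * ((n + i) choose n)"
      using choose_mult[of n "n + i" m] i assms by simp
    also have "(n + i) choose n = (n + i) choose i"
      by (subst binomial_symmetric) auto
    also have "(m choose (n + i)) * ((n + i) choose i) = (m choose i) * ((m - i) choose n)"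
      using choose_mult[of i "n + i" m] i assms by simp
    finally have "real (m choose n) * real ((m - n) choose i) = real (m choose i) * real ((m - i) choose n)"
      by (simp flip: of_nat_mult)
    moreover have "real (m choose i) \<noteq> 0" using i by simp
    ultimately have bin: "real (m choose n) * (real ((m - n) choose i) / real (m choose i)) = real ((m - i) choose n)"
      by (simp add: field_simps)
    have "m - n = (m - n - i) + i" using i by simp
    then have sgn: "(-1 :: real) ^ (m - n - i) * (-1) ^ i = (-1) ^ (m - n)"
      by (metis power_add)
    have "real (m choose n) * ((-1) ^ (m - n - i)
          * (real ((2 * m) choose (2 * i)) * real ((m - n) choose i) / real (m choose i))
          * (- r) ^ i * \<delta> ^ (m - n - i))
        = ((-1) ^ (m - n - i) * (-1) ^ i) * (real ((2 * m) choose (2 * i))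
          * (real (m choose n) * (real ((m - n) choose i) / real (m choose i))) * r ^ i * \<delta> ^ (m - n - i))"
      by (simp add: power_minus[of r])
    then show "real (m choose n) * ((-1) ^ (m - n - i)
          * (real ((2 * m) choose (2 * i)) * real ((m - n) choose i) / real (m choose i))
          * (- r) ^ i * \<delta> ^ (m - n - i))
        = (-1) ^ (m - n) * (real ((2 * m) choose (2 * i)) * real ((m - i) choose n) * r ^ i * \<delta> ^ (m - n - i))"
      unfolding bin sgn .
  qed
  moreover have "(- r + \<delta>) ^ (m - n) = (-1) ^ (m - n) * (r - \<delta>) ^ (m - n)"
    by (simp flip: power_mult_distrib)
  ultimately show ?thesis
    unfolding bound_fun_def gen_laguerre_neg_parameter[OF assms] mult.assoc
    by (simp add: algebra_simps)
qed

text \<open>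
  For \<open>\<delta> < r\<close> this is the bound on the prescribed Taylor coefficients.  When \<open>r = \<delta>\<close> the interval
  is a point and there are no distinct nodes: if \<open>n < m\<close> the factor \<open>(r - \<delta>)\<^sup>m\<^sup>-\<^sup>n\<close> vanishes, and if
  \<open>n = m\<close> the claim is the hypothesis at that single point.
\<close>
lemma admissible_radius_bound_fun_le_0:
  assumes P: "P \<in> exp_polys m n" and nm: "0 < n" "n \<le> m" and \<eta>: "\<eta> < 1"
    and r: "0 \<le> \<delta>" "\<delta> \<le> r" "\<And>x. x \<in> {- r..- \<delta>} \<Longrightarrow> \<bar>poly P x\<bar> \<le> 1 - \<eta>"
  shows "(-1) ^ (m - n) * bound_fun m n \<eta> \<delta> (- r) \<le> 0"
proof -
  define E where "E = (\<Sum>k\<le>n. real ((m - k) choose (n - k)) * (- r) ^ k / fact k)"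
  define W where "W = (\<Sum>j\<le>m - n. real ((2 * m) choose (2 * j)) * real ((m - j) choose n) * r ^ j * \<delta> ^ (m - n - j))"
  have "(r - \<delta>) ^ (m - n) * \<bar>E\<bar> \<le> (1 - \<eta>) * W"
  proof (cases "r = \<delta>")
    case False
    then show ?thesis
      using exp_polys_jet_bound[OF P nm, of "- r" "- \<delta>" "1 - \<eta>"] r by (simp add: E_def W_def)
  next
    case True
    show ?thesis
    proof (cases "n = m")
      case True
      have "degree P = m"
        using True degree_exp_polys[OF P] coeff_exp_polys[OF P, of m] le_degree[of P m] by simp
      then have "poly P (- r) = E"
        unfolding poly_altdef E_def using True coeff_exp_polys[OF P] by simp
      then show ?thesis using r(3)[of "- r"] True \<open>r = \<delta>\<close> by (simp add: W_def)
    next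
      case False
      have "0 \<le> W" unfolding W_def using r by (intro sum_nonneg) auto
      then show ?thesis using True False nm \<eta> by (simp add: power_0_left)
    qed
  qed
  moreover have "(r - \<delta>) ^ (m - n) * ((-1) ^ n * E) \<le> (r - \<delta>) ^ (m - n) * \<bar>E\<bar>"
    using r by (intro mult_left_mono) (auto simp: minus_one_power_iff)
  ultimately have "(r - \<delta>) ^ (m - n) * ((-1) ^ n * E) - (1 - \<eta>) * W \<le> 0" by linarith
  moreover have "(-1) ^ (m - n) * bound_fun m n \<eta> \<delta> (- r)
      = ((-1) ^ (m - n) * (-1) ^ (m - n)) * ((r - \<delta>) ^ (m - n) * ((-1) ^ n * E) - (1 - \<eta>) * W)"
    unfolding bound_fun_uminus[OF nm(2)] E_def W_def by (simp only: mult.assoc)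
  ultimately show ?thesis by (simp flip: power_mult_distrib)
qed

text \<open>
  The Laguerre part has degree \<open>m\<close> in \<open>r\<close> with leading coefficient \<open>1 / n!\<close>, and \<open>0 < n\<close> keeps the
  Chebyshev part, of degree at most \<open>m - n\<close>, from reaching it.
\<close>
lemma bound_fun_as_poly:
  assumes nm: "0 < n" "n \<le> m"
  obtains p where "\<And>r. poly p r = (-1) ^ (m - n) * bound_fun m n \<eta> \<delta> (- r)" and "0 < lead_coeff p"
proof -
  define E where "E = (\<Sum>k\<le>n. monom ((-1) ^ n * (real ((m - k) choose (n - k)) * (-1) ^ k / fact k)) k)"
  define W where "W = (\<Sum>j\<le>m - n. monom (real ((2 * m) choose (2 * j)) * real ((m - j) choose n) * \<delta> ^ (m - n - j)) j)"
  define p where "p = [:- \<delta>, 1:] ^ (m - n) * E - smult (1 - \<eta>) W"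
  have "poly p r = (-1) ^ (m - n) * bound_fun m n \<eta> \<delta> (- r)" for r
  proof -
    have E: "poly E r = (-1) ^ n * (\<Sum>k\<le>n. real ((m - k) choose (n - k)) * (- r) ^ k / fact k)"
      by (simp add: E_def poly_sum poly_monom power_minus[of r] sum_distrib_left mult_ac)
    have W: "poly W r = (\<Sum>j\<le>m - n. real ((2 * m) choose (2 * j)) * real ((m - j) choose n) * r ^ j * \<delta> ^ (m - n - j))"
      by (simp add: W_def poly_sum poly_monom mult_ac)
    have "poly p r = (r - \<delta>) ^ (m - n) * poly E r - (1 - \<eta>) * poly W r"
      by (simp add: p_def poly_power)
    also have "\<dots> = ((-1) ^ (m - n) * (-1) ^ (m - n)) * \<dots>"
      by (simp flip: power_mult_distrib)
    finally show ?thesis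
      unfolding bound_fun_uminus[OF nm(2)] E W by (simp only: mult.assoc)
  qed
  moreover have "0 < lead_coeff p"
  proof -
    have degE: "degree E \<le> n"
      unfolding E_def by (intro degree_sum_le) (auto intro: order.trans[OF degree_monom_le])
    have coeffE: "coeff E n = 1 / fact n"
      by (simp add: E_def coeff_sum sum.delta' flip: power_mult_distrib)
    then have "coeff E n \<noteq> 0" by simp
    then have "n \<le> degree E" by (rule le_degree)
    with degE have degE: "degree E = n" by simp
    then have "E \<noteq> 0" using nm by auto
    have degW: "degree (smult (1 - \<eta>) W) \<le> m - n"
      unfolding W_def
      by (intro order.trans[OF degree_smult_le] degree_sum_le) (auto intro: order.trans[OF degree_monom_le])
    have degA: "degree ([:- \<delta>, 1:] ^ (m - n) * E) = m"
      using \<open>E \<noteq> 0\<close> degE nm by (simp add: degree_mult_eq degree_linear_power)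
    have "lead_coeff ([:- \<delta>, 1:] ^ (m - n) * E) = 1 / fact n"
      using coeffE degE by (simp add: lead_coeff_mult lead_coeff_power)
    moreover have "lead_coeff p = lead_coeff ([:- \<delta>, 1:] ^ (m - n) * E)"
    proof -
      have "degree (- smult (1 - \<eta>) W) < degree ([:- \<delta>, 1:] ^ (m - n) * E)"
        using degW nm unfolding degA by simp
      from lead_coeff_add_le[OF this] show ?thesis by (simp add: p_def add.commute)
    qed
    ultimately show ?thesis by simp
  qed
  ultimately show ?thesis by (rule that)
qed

lemma root_beyond_nonpos_value:
  fixes p :: "real poly"
  assumes "0 < lead_coeff p" and "poly p r \<le> 0"
  obtains s where "r \<le> s" and "poly p s = 0"
proof (cases "poly p r = 0")
  case True
  then show ?thesis using that by blast
next
  case False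
  obtain N where N: "\<And>x. N \<le> x \<Longrightarrow> lead_coeff p \<le> poly p x"
    using poly_pinfty_gt_lc[OF assms(1)] by blast
  have "0 < poly p (max N (r + 1))" using N[of "max N (r + 1)"] assms(1) by simp
  then obtain s where "r < s" "poly p s = 0"
    using poly_IVT_pos[of r "max N (r + 1)" p] False assms(2) by force
  then show ?thesis by (intro that[of s]) auto
qed

section \<open>The bound on the optimal damped radius\<close>

theorem theorem11:
  fixes m n :: nat and \<eta> \<delta> :: real
  assumes "0 \<le> \<eta>" and "\<eta> < 1" and "0 \<le> \<delta>" and "0 < n" and "n \<le> m"
  shows "(\<forall>\<xi>. smallest_negative_solution (bound_fun m n \<eta> \<delta>) \<xi>
              \<longrightarrow> optimal_damped_radius m n \<eta> \<delta> \<le> ereal (- \<xi>))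
       \<and> (optimal_damped_radius m n \<eta> \<delta> \<noteq> -\<infinity>
              \<longrightarrow> (\<exists>\<xi>. smallest_negative_solution (bound_fun m n \<eta> \<delta>) \<xi>))"
proof -
  obtain p where p: "\<And>r. poly p r = (-1) ^ (m - n) * bound_fun m n \<eta> \<delta> (- r)" "0 < lead_coeff p"
    using bound_fun_as_poly assms(4,5) by blast
  have root_iff: "poly p r = 0 \<longleftrightarrow> bound_fun m n \<eta> \<delta> (- r) = 0" for r
    by (simp add: p(1))
  define Adm where "Adm P = {r. 0 < r \<and> \<delta> \<le> r \<and> (\<forall>x\<in>{- r..- \<delta>}. \<bar>poly P x\<bar> \<le> 1 - \<eta>)}" for P
  have radius: "optimal_damped_radius m n \<eta> \<delta> = (SUP P\<in>exp_polys m n. SUP r\<in>Adm P. ereal r)"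
    by (simp add: optimal_damped_radius_def damped_radius_def Adm_def)
  have root_beyond: "\<exists>s\<ge>r. bound_fun m n \<eta> \<delta> (- s) = 0"
    if "P \<in> exp_polys m n" and "r \<in> Adm P" for P r
  proof -
    have "poly p r \<le> 0"
      unfolding p(1) using that assms by (intro admissible_radius_bound_fun_le_0) (auto simp: Adm_def)
    then obtain s where "r \<le> s" "poly p s = 0"
      using root_beyond_nonpos_value p(2) by blast
    then show ?thesis by (auto simp: root_iff)
  qed
  show ?thesis
  proof (intro conjI allI impI)
    fix \<xi> assume \<xi>: "smallest_negative_solution (bound_fun m n \<eta> \<delta>) \<xi>"
    have "r \<le> - \<xi>" if Pr: "P \<in> exp_polys m n" "r \<in> Adm P" for P r
    proof -
      obtain s where s: "r \<le> s" "bound_fun m n \<eta> \<delta> (- s) = 0"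
        using root_beyond[OF Pr] by blast
      have "0 < r" using Pr by (simp add: Adm_def)
      then have "\<xi> \<le> - s" using \<xi> s by (auto simp: smallest_negative_solution_def)
      then show ?thesis using s by simp
    qed
    then show "optimal_damped_radius m n \<eta> \<delta> \<le> ereal (- \<xi>)"
      unfolding radius by (intro SUP_least) simp
  next
    assume "optimal_damped_radius m n \<eta> \<delta> \<noteq> - \<infinity>"
    then obtain P r where Pr: "P \<in> exp_polys m n" "r \<in> Adm P"
      unfolding radius by (metis SUP_least bot_ereal_def le_bot)
    define Z where "Z = {s. 0 < s \<and> poly p s = 0}"
    have "finite Z"
      by (rule finite_subset[OF _ poly_roots_finite[of p]]) (use p(2) in \<open>auto simp: Z_def\<close>)
    moreover have "Z \<noteq> {}"
      using root_beyond[OF Pr] Pr(2) by (force simp: Z_def Adm_def root_iff)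
    ultimately have "Max Z \<in> Z" and Max: "\<And>s. s \<in> Z \<Longrightarrow> s \<le> Max Z"
      by auto
    moreover have "- Max Z \<le> x" if "x < 0" "bound_fun m n \<eta> \<delta> x = 0" for x
      using Max[of "- x"] that by (simp add: Z_def root_iff)
    ultimately have "smallest_negative_solution (bound_fun m n \<eta> \<delta>) (- Max Z)"
      by (auto simp: smallest_negative_solution_def Z_def root_iff)
    then show "\<exists>\<xi>. smallest_negative_solution (bound_fun m n \<eta> \<delta>) \<xi>" by blast
  qed
qed

end
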